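(* Let $A$ be a real $m\times n$ matrix, let $D$ be a matrix in $\mathrm{Tan}^{\Sigma}_A$, and let $S$ be the pattern of $A$ in the direction of $D$. If $A$ has the SSVP with respect to $S$, then there is a real $m\times n$ matrix $B$ with pattern $S$ that has the same singular values (with multiplicity) as $A$ and has the SSVP.
   Context: All matrices are real. A pattern is a matrix with entries in $\{0,1\}$. The pattern of a matrix is the $(0,1)$-matrix obtained by replacing each nonzero entry by $1$. A superpattern of a pattern is a pattern obtained from it by changing some zeros to ones. $A\circ X$ is the entrywise (Schur) product. For $m\le n$ the singular values of an $m\times n$ matrix $A$ are the $m$ nonnegative square roots of the eigenvalues of $AA^\top$; for $m>n$ the same formula may be used. $\mathrm{Tan}^{\Sigma}_A=\{KA+AL : K\in\mathbb{R}^{m\times m}\text{ and }L\in\mathbb{R}^{n\times n}\text{ skew-symmetric}\}$. For $A=[a_{ij}]$ and an $m\times n$ matrix $D=[d_{ij}]$, the pattern of $A$ in the direction of $D$ is the $m\times n$ pattern $S=[s_{ij}]$ with $s_{ij}=1$ if $a_{ij}\neq 0$ or $d_{ij}\ne 0$, and $s_{ij}=0$ otherwise. For a superpattern $S$ of the pattern of $A$, $A$ has the SSVP with respect to $S$ if $Y=O$ is the only $m\times n$ matrix such that $A^\top Y$ is symmetric, $YA^\top$ is symmetric, and $S\circ Y=O$. The matrix $B$ has the Strong Singular Value Property (SSVP) if $X=O$ is the only $m\times n$ matrix such that $XB^\top$ is symmetric, $B^\top X$ is symmetric, and $B\circ X=O$. *)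

theory Defs
  imports "HOL-Analysis.Analysis" "HOL-Computational_Algebra.Polynomial"
begin

text \<open>
  A real $m \times n$ matrix is an element of \<^typ>\<open>real^'n^'m\<close>, with $m$ the cardinality of
  \<^typ>\<open>'m\<close> (rows) and $n$ the cardinality of \<^typ>\<open>'n\<close> (columns).
\<close>

definition symmetric_mat :: "real^'n^'n \<Rightarrow> bool" where
  "symmetric_mat M \<longleftrightarrow> transpose M = M"

definition skew_symmetric_mat :: "real^'n^'n \<Rightarrow> bool" where
  "skew_symmetric_mat M \<longleftrightarrow> transpose M = - M"

definition schur_prod :: "real^'n^'m \<Rightarrow> real^'n^'m \<Rightarrow> real^'n^'m" where
  "schur_prod A X = (\<chi> i j. A $ i $ j * X $ i $ j)"

definition pattern_of :: "real^'n^'m \<Rightarrow> real^'n^'m" where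
  "pattern_of A = (\<chi> i j. if A $ i $ j \<noteq> 0 then 1 else 0)"

definition pattern_in_direction :: "real^'n^'m \<Rightarrow> real^'n^'m \<Rightarrow> real^'n^'m" where
  "pattern_in_direction A D = (\<chi> i j. if A $ i $ j \<noteq> 0 \<or> D $ i $ j \<noteq> 0 then 1 else 0)"

text \<open>The characteristic polynomial $\det(x I - M)$, a monic polynomial of degree the size of $M$.\<close>

definition charpoly :: "real^'n^'n \<Rightarrow> real poly" where
  "charpoly M = det (\<chi> i j. (if i = j then [:0, 1:] else 0) - [:M $ i $ j:])"

definition eigenvalues_mset :: "real^'n^'n \<Rightarrow> real multiset" where
  "eigenvalues_mset M = proots (charpoly M)"

text \<open>
  The Gram matrix \<^term>\<open>A ** transpose A\<close> is symmetric and positive semidefinite, so all its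
  complex eigenvalues are real and nonnegative, and this multiset has exactly $m$ elements
  (also when $m > n$).
\<close>

definition singular_values :: "real^'n^'m \<Rightarrow> real multiset" where
  "singular_values A = image_mset sqrt (eigenvalues_mset (A ** transpose A))"

definition Tan_Sigma :: "real^'n^'m \<Rightarrow> (real^'n^'m) set" where
  "Tan_Sigma A = {K ** A + A ** L | (K :: real^'m^'m) (L :: real^'n^'n).
     skew_symmetric_mat K \<and> skew_symmetric_mat L}"

text \<open>Intended for $(0,1)$-matrices \<^term>\<open>S\<close> that are superpatterns of \<^term>\<open>pattern_of A\<close>.\<close>

definition has_SSVP_wrt :: "real^'n^'m \<Rightarrow> real^'n^'m \<Rightarrow> bool" where
  "has_SSVP_wrt A S \<longleftrightarrow>
     (\<forall>Y :: real^'n^'m. symmetric_mat (transpose A ** Y) \<and> symmetric_mat (Y ** transpose A)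
        \<and> schur_prod S Y = 0 \<longrightarrow> Y = 0)"

definition has_SSVP :: "real^'n^'m \<Rightarrow> bool" where
  "has_SSVP B \<longleftrightarrow>
     (\<forall>X :: real^'n^'m. symmetric_mat (X ** transpose B) \<and> symmetric_mat (transpose B ** X)
        \<and> schur_prod B X = 0 \<longrightarrow> X = 0)"

end

theory Submission
  imports Defs
begin

text \<open>
  Write \<open>D = K A + A L\<close> and let \<open>Q\<close> be the Cayley transform, so \<open>Q(M) = 1 + 2 M + O(M\<^sup>2)\<close> is
  orthogonal for skew-symmetric \<open>M\<close>. The map \<open>g(M, N, X) = Q(M) A Q(N) - A - S \<circ> X\<close> vanishes at
  the origin; by the SSVP with respect to \<open>S\<close>, which says that the orthogonal complements of the
  tangent space and of the matrices supported on \<open>S\<close> meet only in \<open>0\<close>, its derivative there is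
  onto. Since \<open>D\<close> is supported on \<open>S\<close>, the vector \<open>(K/2, L/2, D)\<close> lies in the kernel of the
  derivative, so Brouwer's theorem gives zeros of \<open>g\<close> at distance \<open>o(t)\<close> from its multiple by
  \<open>t\<close>. At such a zero, \<open>B = A + S \<circ> X = Q(M) A Q(N)\<close> has the singular values of \<open>A\<close>, and
  \<open>X = t D + o(t)\<close> forces the pattern \<open>S\<close> for small \<open>t\<close>. The SSVP with respect to a fixed \<open>S\<close> is
  an open condition, so \<open>B\<close> inherits it.
\<close>

section \<open>Matrix product, transpose and Schur product under the Frobenius inner product\<close>

lemma bounded_bilinear_matrix_mul:
  "bounded_bilinear ((**) :: real^'k^'m \<Rightarrow> real^'n^'k \<Rightarrow> real^'n^'m)"
proof -
  have "bilinear ((**) :: real^'k^'m \<Rightarrow> real^'n^'k \<Rightarrow> real^'n^'m)"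
    unfolding bilinear_def
    by (auto intro!: linearI simp: matrix_matrix_mult_def vec_eq_iff algebra_simps
        sum.distrib sum_distrib_left)
  then show ?thesis
    by (simp add: bilinear_conv_bounded_bilinear)
qed

interpretation matrix_mul: bounded_bilinear "(**) :: real^'k^'m \<Rightarrow> real^'n^'k \<Rightarrow> real^'n^'m"
  by (rule bounded_bilinear_matrix_mul)

lemma linear_transpose: "linear (transpose :: real^'n^'m \<Rightarrow> real^'m^'n)"
  by (rule linearI) (simp_all add: transpose_def vec_eq_iff)

lemmas transpose_linear_simps =
  linear_add[OF linear_transpose] linear_diff[OF linear_transpose]
  linear_neg[OF linear_transpose] linear_0[OF linear_transpose]

lemma linear_schur_prod: "linear (schur_prod S)"
  by (rule linearI) (simp_all add: schur_prod_def vec_eq_iff algebra_simps)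

text \<open>Multiplication by \<open>transpose A\<close> is the Frobenius adjoint of multiplication
  by \<open>A\<close>. With \<open>inner_matrix_mul_right\<close>, this turns orthogonality to a
  tangent space into the two symmetry conditions of the SSVP.\<close>

lemma inner_matrix_mul_left:
  fixes Y :: "real^'n^'m"
  shows "Y \<bullet> (M ** A) = (Y ** transpose A) \<bullet> M"
proof -
  have "Y \<bullet> (M ** A) = (\<Sum>i\<in>UNIV. \<Sum>j\<in>UNIV. \<Sum>k\<in>UNIV. Y$i$j * M$i$k * A$k$j)"
    by (simp add: inner_vec_def matrix_matrix_mult_def sum_distrib_left mult.assoc)
  also have "\<dots> = (\<Sum>i\<in>UNIV. \<Sum>k\<in>UNIV. \<Sum>j\<in>UNIV. Y$i$j * M$i$k * A$k$j)"
    by (intro sum.cong refl sum.swap)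
  also have "\<dots> = (Y ** transpose A) \<bullet> M"
    by (simp add: inner_vec_def matrix_matrix_mult_def transpose_def sum_distrib_left mult_ac)
  finally show ?thesis .
qed

lemma inner_transpose: "transpose X \<bullet> transpose Y = X \<bullet> (Y :: real^'n^'m)"
  unfolding inner_vec_def transpose_def by (simp add: sum.swap[of _ "UNIV :: 'n set"])

lemma inner_transpose_swap: "X \<bullet> transpose Y = transpose X \<bullet> (Y :: real^'n^'m)"
  by (metis inner_transpose transpose_transpose)

lemma inner_matrix_mul_right:
  fixes Y :: "real^'n^'m"
  shows "Y \<bullet> (A ** N) = (transpose A ** Y) \<bullet> N"
proof -
  have "Y \<bullet> (A ** N) = transpose Y \<bullet> (transpose N ** transpose A)"
    by (metis inner_transpose matrix_transpose_mul)
  also have "\<dots> = (transpose Y ** A) \<bullet> transpose N"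
    by (simp add: inner_matrix_mul_left)
  also have "\<dots> = (transpose A ** Y) \<bullet> N"
    by (simp add: inner_transpose_swap matrix_transpose_mul)
  finally show ?thesis .
qed

lemma inner_schur_prod: "Y \<bullet> schur_prod S X = schur_prod S Y \<bullet> X"
  by (simp add: inner_vec_def schur_prod_def mult_ac)

section \<open>Invariance of singular values under orthogonal equivalence\<close>

text \<open>Lifted to polynomial matrices by \<open>C\<close>, the scalar matrix of x commutes with
  \<open>C U\<close>, so U (x - M) V = x - U M V; the determinants of the lifted \<open>U\<close>
  and \<open>V\<close> multiply to 1.\<close>

lemma charpoly_similar:
  fixes U M :: "real^'n^'n"
  assumes "U ** V = mat 1"
  shows "charpoly (U ** M ** V) = charpoly M"
proof -
  define C :: "real^'n^'n \<Rightarrow> real poly^'n^'n" where "C P = (\<chi> i j. [:P$i$j:])" for P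
  have C_mult: "C (P ** Q) = C P ** C Q" for P Q
  proof -
    have const_add: "[:a + b:] = [:a:] + [:b:]" for a b :: real
      by simp
    have "[:\<Sum>k\<in>K. f k:] = (\<Sum>k\<in>K. [:f k:])" if "finite K" for f :: "'n \<Rightarrow> real" and K
      using that by (induction K rule: finite_induct) (simp_all add: const_add del: add_pCons)
    then show ?thesis
      by (simp add: C_def matrix_matrix_mult_def vec_eq_iff mult.commute)
  qed
  have C_1: "C (mat 1) = mat 1"
    by (simp add: C_def mat_def vec_eq_iff one_pCons)
  have charpoly_eq: "charpoly P = det (mat [:0, 1:] - C P)" for P
    unfolding charpoly_def C_def mat_def by (rule arg_cong[of _ _ det]) (simp add: vec_eq_iff)
  have mat_comm: "C U ** mat x = mat x ** C U" for x
    by (simp add: matrix_matrix_mult_def mat_def vec_eq_iff if_distrib if_distribR mult.commute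
        cong: if_cong)
  have diff_distrib: "P ** (Q - R) = P ** Q - P ** R" "(Q - R) ** P = Q ** P - R ** P"
    for P Q R :: "real poly^'n^'n"
    by (simp_all add: matrix_matrix_mult_def vec_eq_iff algebra_simps sum_subtractf)
  have "C U ** (mat [:0, 1:] - C M) ** C V
      = mat [:0, 1:] ** (C U ** C V) - C U ** C M ** C V"
    by (simp add: diff_distrib mat_comm matrix_mul_assoc)
  also have "\<dots> = mat [:0, 1:] - C (U ** M ** V)"
    by (simp add: C_mult[symmetric] assms C_1)
  finally have "charpoly (U ** M ** V) = det (C U ** (mat [:0, 1:] - C M) ** C V)"
    by (simp add: charpoly_eq)
  also have "\<dots> = det (C U ** C V) * charpoly M"
    by (simp add: det_mul charpoly_eq mult_ac)
  also have "\<dots> = charpoly M"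
    by (simp add: C_mult[symmetric] assms C_1)
  finally show ?thesis .
qed

lemma singular_values_orthogonal:
  fixes A :: "real^'n^'m"
  assumes "orthogonal_matrix U" "orthogonal_matrix V"
  shows "singular_values (U ** A ** V) = singular_values A"
proof -
  have "(U ** A ** V) ** transpose (U ** A ** V)
      = U ** A ** (V ** transpose V) ** transpose A ** transpose U"
    by (simp add: matrix_transpose_mul matrix_mul_assoc)
  also have "\<dots> = U ** (A ** transpose A) ** transpose U"
    using assms by (simp add: orthogonal_matrix_def matrix_mul_assoc)
  finally show ?thesis
    using assms charpoly_similar[of U "transpose U" "A ** transpose A"]
    by (simp add: singular_values_def eigenvalues_mset_def orthogonal_matrix_def)
qed

section \<open>The Cayley transform and its derivative at the origin\<close>

text \<open>
  The Cayley parametrization \<open>M \<mapsto> (1 - M)\<inverse> (1 + M)\<close> of orthogonal matrices by skew-symmetric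
  ones, precomposed with the projection onto the skew-symmetric matrices.
\<close>

definition skew_part :: "real^'n^'n \<Rightarrow> real^'n^'n" where
  "skew_part M = (1/2) *\<^sub>R (M - transpose M)"

definition resolvent :: "real^'n^'n \<Rightarrow> real^'n^'n" where
  "resolvent M = matrix_inv (mat 1 - skew_part M)"

definition cayley :: "real^'n^'n \<Rightarrow> real^'n^'n" where
  "cayley M = resolvent M ** (mat 1 + skew_part M)"

lemma linear_skew_part: "linear skew_part"
  by (rule linearI) (simp_all add: skew_part_def transpose_def vec_eq_iff algebra_simps)

lemma skew_part_skew: "skew_symmetric_mat M \<Longrightarrow> skew_part M = M"
  by (simp add: skew_part_def skew_symmetric_mat_def vec_eq_iff)

lemma transpose_skew_part: "transpose (skew_part M) = - skew_part M"
  by (simp add: skew_part_def transpose_def vec_eq_iff field_simps)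

lemma inner_skew_part: "X \<bullet> (skew_part M ** X) = 0"
proof -
  have "X \<bullet> (skew_part M ** X) = (transpose (skew_part M) ** X) \<bullet> X"
    by (rule inner_matrix_mul_right)
  also have "\<dots> = - (X \<bullet> (skew_part M ** X))"
    by (simp add: transpose_skew_part matrix_mul.minus_left inner_commute)
  finally show ?thesis by simp
qed

text \<open>For the skew part K of \<open>M\<close>, x is orthogonal to K x. Hence x = K x forces x
  = 0, and 1 - K is invertible for every \<open>M\<close>.\<close>

lemma resolvent_mul:
  "(mat 1 - skew_part M) ** resolvent M = mat 1" "resolvent M ** (mat 1 - skew_part M) = mat 1"
proof -
  have "x = 0" if "(mat 1 - skew_part M) *v x = 0" for x
  proof -
    have "x v* skew_part M = - (skew_part M *v x)"
      unfolding transpose_matrix_vector[symmetric] transpose_skew_part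
      by (simp add: matrix_vector_mult_def vec_eq_iff sum_negf)
    then have "x \<bullet> (skew_part M *v x) = - (x \<bullet> (skew_part M *v x))"
      by (metis dot_lmul_matrix inner_commute inner_minus_right)
    then have "x \<bullet> (skew_part M *v x) = 0"
      by simp
    moreover have "x = skew_part M *v x"
      using that by (simp add: matrix_vector_mult_diff_rdistrib)
    ultimately show "x = 0" by (metis inner_eq_zero_iff)
  qed
  then have "invertible (mat 1 - skew_part M)"
    by (simp add: invertible_left_inverse matrix_left_invertible_ker)
  then have "(mat 1 - skew_part M) ** resolvent M = mat 1 \<and> resolvent M ** (mat 1 - skew_part M) = mat 1"
    unfolding resolvent_def matrix_inv_def invertible_def by (rule someI_ex)
  then show "(mat 1 - skew_part M) ** resolvent M = mat 1"
      "resolvent M ** (mat 1 - skew_part M) = mat 1"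
    by auto
qed

text \<open>Pairing (1 - K) R = 1 with R kills the skew term and leaves |R|^2 = R \<bullet> 1, to
  which Cauchy-Schwarz applies. The bound is uniform in \<open>M\<close>, which serves both
  continuity and the quadratic remainder of the Cayley transform.\<close>

lemma norm_resolvent_le: "norm (resolvent M) \<le> norm (mat 1 :: real^'n^'n)"
  for M :: "real^'n^'n"
proof -
  let ?R = "resolvent M"
  have "?R \<bullet> ((mat 1 - skew_part M) ** ?R) = ?R \<bullet> ?R"
    by (simp add: matrix_mul.diff_left inner_diff_right inner_skew_part)
  then have "norm ?R * norm ?R = ?R \<bullet> mat 1"
    by (simp add: resolvent_mul norm_eq_sqrt_inner)
  also have "\<dots> \<le> norm ?R * norm (mat 1 :: real^'n^'n)"
    by (rule norm_cauchy_schwarz)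
  finally show ?thesis
    by (cases "?R = 0") auto
qed

lemma resolvent_diff: "resolvent M - resolvent N = resolvent M ** skew_part (M - N) ** resolvent N"
proof -
  have "resolvent M ** skew_part (M - N) ** resolvent N
      = resolvent M ** ((mat 1 - skew_part N) - (mat 1 - skew_part M)) ** resolvent N"
    by (simp add: linear_diff[OF linear_skew_part])
  also have "\<dots> = resolvent M ** ((mat 1 - skew_part N) ** resolvent N)
      - (resolvent M ** (mat 1 - skew_part M)) ** resolvent N"
    by (simp only: matrix_mul.diff_left matrix_mul.diff_right matrix_mul_assoc)
  also have "\<dots> = resolvent M - resolvent N"
    by (simp add: resolvent_mul)
  finally show ?thesis ..
qed

lemma continuous_resolvent: "continuous_on UNIV (resolvent :: real^'n^'n \<Rightarrow> _)"
proof -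
  have "isCont resolvent N" for N :: "real^'n^'n"
  proof -
    have "((\<lambda>M. skew_part (M - N)) \<longlongrightarrow> skew_part (N - N)) (at N)"
      by (intro linear_continuous_at[OF linear_skew_part[unfolded linear_conv_bounded_linear],
            THEN isCont_tendsto_compose] tendsto_intros)
    then have *: "((\<lambda>M. skew_part (M - N)) \<longlongrightarrow> 0) (at N)"
      by (simp add: linear_0[OF linear_skew_part])
    have bounded: "Bfun resolvent (at N)"
      by (rule BfunI[of _ "norm (mat 1 :: real^'n^'n)"]) (simp add: norm_resolvent_le)
    \<comment> \<open>By the uniform bound this is a bounded factor times a null one, so no prior
      continuity of \<open>resolvent\<close> enters.\<close>
    have "((\<lambda>M. resolvent M ** skew_part (M - N)) \<longlongrightarrow> 0) (at N)"
      using matrix_mul.Bfun_prod_Zfun[OF bounded] * by (simp add: tendsto_Zfun_iff)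
    then have "((\<lambda>M. resolvent M ** skew_part (M - N) ** resolvent N) \<longlongrightarrow> 0) (at N)"
      by (rule matrix_mul.tendsto_left_zero)
    then show ?thesis
      by (simp add: isCont_def resolvent_diff[symmetric] LIM_zero_iff)
  qed
  then show ?thesis by (simp add: continuous_at_imp_continuous_on)
qed


text \<open>Transposition exchanges 1 + K and 1 - K, and these two commute, so each cancels against
  a resolvent or its transpose.\<close>

lemma cayley_orthogonal: "orthogonal_matrix (cayley M)"
proof -
  let ?S = "skew_part M" and ?R = "resolvent M"
  have "transpose (?R ** (mat 1 - ?S)) = mat 1"
    by (simp add: resolvent_mul)
  then have R: "(mat 1 + ?S) ** transpose ?R = mat 1"
    by (simp add: matrix_transpose_mul transpose_linear_simps transpose_skew_part)
  have "cayley M ** transpose (cayley M)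
      = ?R ** ((mat 1 + ?S) ** (mat 1 - ?S)) ** transpose ?R"
    by (simp add: cayley_def matrix_transpose_mul transpose_linear_simps transpose_skew_part
        matrix_mul_assoc)
  also have "(mat 1 + ?S) ** (mat 1 - ?S) = (mat 1 - ?S) ** (mat 1 + ?S)"
    by (simp add: matrix_mul.add_left matrix_mul.add_right matrix_mul.diff_left
        matrix_mul.diff_right)
  also have "?R ** ((mat 1 - ?S) ** (mat 1 + ?S)) ** transpose ?R
      = (?R ** (mat 1 - ?S)) ** ((mat 1 + ?S) ** transpose ?R)"
    by (simp add: matrix_mul_assoc)
  also have "\<dots> = mat 1"
    by (simp add: R resolvent_mul)
  finally show ?thesis
    using orthogonal_matrix[of "transpose (cayley M)"] by simp
qed

lemma cayley_0: "cayley 0 = mat 1"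
  using resolvent_mul(1)[of 0] by (simp add: cayley_def linear_0[OF linear_skew_part])

lemma continuous_cayley: "continuous_on UNIV cayley"
  unfolding cayley_def
  by (intro matrix_mul.continuous_on continuous_resolvent continuous_intros
      linear_continuous_on linear_skew_part[unfolded linear_conv_bounded_linear])

lemma has_derivative_0_quadratic:
  assumes "\<And>x. norm (f x) \<le> C * (norm x)\<^sup>2"
  shows "(f has_derivative (\<lambda>_. 0)) (at 0)"
  unfolding has_derivative_at_alt
proof (intro conjI allI impI)
  fix e :: real
  assume e: "e > 0"
  \<comment> \<open>Adding 1 keeps the denominator positive when \<open>C\<close> is 0.\<close>
  define d where "d = e / (\<bar>C\<bar> + 1)"
  have "norm (f x) \<le> e * norm x" if "norm x < d" for x
  proof -
    have "\<bar>C\<bar> * norm x \<le> (\<bar>C\<bar> + 1) * d"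
      using that by (intro mult_mono) auto
    then have "\<bar>C\<bar> * norm x \<le> e"
      by (simp add: d_def add_pos_nonneg)
    have "norm (f x) \<le> \<bar>C\<bar> * (norm x)\<^sup>2"
      using assms[of x] by (rule order_trans) (intro mult_right_mono, auto)
    also have "\<dots> = (\<bar>C\<bar> * norm x) * norm x"
      by (simp add: power2_eq_square)
    also have "\<dots> \<le> e * norm x"
      using \<open>\<bar>C\<bar> * norm x \<le> e\<close> by (rule mult_right_mono) simp
    finally show ?thesis .
  qed
  moreover have "f 0 = 0"
    using assms[of 0] by simp
  moreover have "d > 0"
    using e by (simp add: d_def)
  ultimately show "\<exists>d>0. \<forall>y. norm (y - 0) < d \<longrightarrow> norm (f y - f 0 - 0) \<le> e * norm (y - 0)"
    by auto
qed simp

text \<open>Using R = 1 + R K repeatedly gives the exact expansion 1 + 2 K + 2 R K K. The last term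
  is quadratically small because R is bounded, and 2 K is \<open>M - transpose M\<close>.\<close>

lemma has_derivative_cayley:
  "((cayley :: real^'n^'n \<Rightarrow> _) has_derivative (\<lambda>M. M - transpose M)) (at 0)"
proof -
  have skew_0: "skew_part 0 = 0"
    by (simp add: linear_0[OF linear_skew_part])
  have cayley_eq: "cayley M = mat 1 + 2 *\<^sub>R skew_part M + 2 *\<^sub>R (resolvent M ** skew_part M ** skew_part M)"
    for M :: "real^'n^'n"
  proof -
    let ?S = "skew_part M" and ?R = "resolvent M"
    have R: "?R = mat 1 + ?R ** ?S"
      using resolvent_mul(2)[of M] by (simp add: matrix_mul.diff_right algebra_simps)
    have "?R ** ?S = (mat 1 + ?R ** ?S) ** ?S"
      by (rule arg_cong[where f = "\<lambda>P. P ** ?S", OF R])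
    then have RS: "?R ** ?S = ?S + ?R ** ?S ** ?S"
      by (simp only: matrix_mul.add_left matrix_mul_lid)
    have "cayley M = ?R + ?R ** ?S"
      unfolding cayley_def by (simp add: matrix_mul.add_right)
    then have "cayley M = (mat 1 + (?S + ?R ** ?S ** ?S)) + (?S + ?R ** ?S ** ?S)"
      by (simp only: R[symmetric] RS[symmetric])
    then show ?thesis
      by (simp only: scaleR_2 add_ac)
  qed
  obtain B where B: "B > 0" "\<And>M :: real^'n^'n. norm (skew_part M) \<le> B * norm M"
    using linear_bounded_pos[OF linear_skew_part] by auto
  obtain b where b: "b > 0" "\<And>(P :: real^'n^'n) (Q :: real^'n^'n). norm (P ** Q) \<le> norm P * norm Q * b"
    using matrix_mul.pos_bounded by blast
  let ?k = "norm (mat 1 :: real^'n^'n)"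
  have "norm (resolvent M ** skew_part M ** skew_part M) \<le> (?k * B * b * B * b) * (norm M)\<^sup>2"
    for M :: "real^'n^'n"
  proof -
    have "norm (resolvent M ** skew_part M) \<le> norm (resolvent M) * norm (skew_part M) * b"
      by (rule b(2))
    also have "\<dots> \<le> ?k * (B * norm M) * b"
      using b(1) B(1) by (intro mult_right_mono mult_mono norm_resolvent_le B(2)) auto
    finally have RS: "norm (resolvent M ** skew_part M) \<le> ?k * (B * norm M) * b" .
    have "norm (resolvent M ** skew_part M ** skew_part M)
        \<le> norm (resolvent M ** skew_part M) * norm (skew_part M) * b"
      by (rule b(2))
    also have "\<dots> \<le> ?k * (B * norm M) * b * (B * norm M) * b"
      using b(1) B(1) by (intro mult_right_mono mult_mono RS B(2)) auto
    finally show ?thesis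
      by (simp add: power2_eq_square mult_ac)
  qed
  then have remainder: "((\<lambda>M :: real^'n^'n. resolvent M ** skew_part M ** skew_part M)
      has_derivative (\<lambda>_. 0)) (at 0)"
    by (rule has_derivative_0_quadratic)
  have "((\<lambda>M :: real^'n^'n. mat 1 + 2 *\<^sub>R skew_part M
        + 2 *\<^sub>R (resolvent M ** skew_part M ** skew_part M))
      has_derivative (\<lambda>M. 0 + 2 *\<^sub>R skew_part M + 2 *\<^sub>R 0)) (at 0)"
    by (intro has_derivative_add has_derivative_const has_derivative_scaleR_right remainder
        bounded_linear_imp_has_derivative linear_skew_part[unfolded linear_conv_bounded_linear])
  then show ?thesis
    by (simp add: cayley_eq[abs_def] skew_part_def)
qed

section \<open>Zeros near a kernel direction\<close>

text \<open>
  For a fixed small \<open>t\<close>, Brouwer's theorem is applied to \<open>z \<mapsto> g (t (v + R z)) / t\<close>, with \<open>R\<close> a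
  right inverse of \<open>g'\<close>; this map is close to the identity.
\<close>

lemma zeros_tangent_to_kernel:
  fixes g :: "'a::euclidean_space \<Rightarrow> 'b::euclidean_space"
  assumes cont: "continuous_on UNIV g"
    and der: "(g has_derivative g') (at 0)"
    and g0: "g 0 = 0"
    and surj: "surj g'"
    and v: "g' v = 0"
    and e: "e > 0"
  obtains d where "d > 0"
    "\<And>t. 0 < t \<Longrightarrow> t < d \<Longrightarrow> \<exists>w. g w = 0 \<and> norm (w - t *\<^sub>R v) \<le> e * t"
proof -
  have lin: "linear g'"
    using der has_derivative_linear by blast
  obtain R where R: "linear R" "g' \<circ> R = id"
    using linear_surjective_right_inverse[OF lin surj] by auto
  obtain B where B: "B > 0" "\<And>z. norm (R z) \<le> B * norm z"
    using linear_bounded_pos[OF R(1)] by blast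
  \<comment> \<open>\<open>R\<close> maps the ball of radius \<open>r\<close> into the ball of
    radius \<open>e\<close>, so \<open>c\<close> bounds \<open>v + R z\<close> there. A relative
    error of \<open>r / c\<close> at points of norm at most \<open>t * c\<close> then costs at most
    \<open>r * t\<close>.\<close>
  define r where "r = e / B"
  define c where "c = norm v + e"
  have r: "r > 0" and c: "c > 0"
    using e B by (auto simp: r_def c_def add_nonneg_pos)
  have "\<exists>d>0. \<forall>y. norm (y - 0) < d \<longrightarrow> norm (g y - g 0 - g' (y - 0)) \<le> r / c * norm (y - 0)"
    using der divide_pos_pos[OF r c] unfolding has_derivative_at_alt by blast
  then obtain d where d: "d > 0"
    and approx: "\<And>y. norm y < d \<Longrightarrow> norm (g y - g' y) \<le> r / c * norm y"
    by (auto simp: g0)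
  show thesis
  proof
    show "d / c > 0"
      using d c by simp
    fix t :: real
    assume t: "0 < t" "t < d / c"
    define w where "w z = t *\<^sub>R (v + R z)" for z
    have g'_w: "g' (w z) = t *\<^sub>R z" for z
      using R(2) v by (simp add: w_def linear_add[OF lin] linear_cmul[OF lin] fun_eq_iff)
    have R_le: "norm (R z) \<le> e" if "norm z \<le> r" for z
      using B(2)[of z] mult_left_mono[OF that, of B] B(1) by (simp add: r_def)
    have close: "norm (z - (1/t) *\<^sub>R g (w z)) \<le> r" if z: "norm z \<le> r" for z
    proof -
      have "norm (v + R z) \<le> c"
        using norm_triangle_ineq[of v "R z"] R_le[OF z] by (simp add: c_def)
      then have w_le: "norm (w z) \<le> t * c"
        using t by (simp add: w_def)
      also have "t * c < d"
        using t c by (simp add: field_simps)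
      finally have "norm (g (w z) - g' (w z)) \<le> r / c * norm (w z)"
        by (rule approx)
      also have "\<dots> \<le> r / c * (t * c)"
        using w_le r c by (intro mult_left_mono) auto
      also have "\<dots> = r * t"
        using c by simp
      finally have "norm (t *\<^sub>R z - g (w z)) \<le> r * t"
        by (simp add: g'_w norm_minus_commute)
      moreover have "z - (1/t) *\<^sub>R g (w z) = (1/t) *\<^sub>R (t *\<^sub>R z - g (w z))"
        using t by (simp add: scaleR_diff_right)
      ultimately show ?thesis
        using t by (simp add: divide_simps mult.commute)
    qed
    have cont_w: "continuous_on (cball 0 r) (\<lambda>z. (1/t) *\<^sub>R g (w z))"
      unfolding w_def using R(1)
      by (intro continuous_intros continuous_on_compose2[OF cont] linear_continuous_on)
        (auto simp: linear_conv_bounded_linear)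
    \<comment> \<open>By \<open>close\<close>, subtracting the map from the identity sends the ball
      into itself; a fixed point of the difference is a zero.\<close>
    obtain z where "z \<in> cball 0 r" "(1/t) *\<^sub>R g (w z) = 0"
      using brouwer_surjective_cball[OF cont_w r, of 0 "{0}"] close by auto
    then have "g (w z) = 0" "norm (R z) \<le> e"
      using t R_le by auto
    then show "\<exists>w. g w = 0 \<and> norm (w - t *\<^sub>R v) \<le> e * t"
      using t by (intro exI[of _ "w z"]) (simp add: w_def scaleR_add_right mult.commute)
  qed
qed

section \<open>Openness of the SSVP and transversality\<close>

text \<open>The SSVP with respect to \<open>S\<close> says that a linear map depending continuously on \<open>A\<close> is injective.\<close>

lemma has_SSVP_wrt_open:
  fixes A S :: "real^'n^'m"
  assumes "has_SSVP_wrt A S"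
  obtains d where "d > 0" "\<And>B. norm (B - A) < d \<Longrightarrow> has_SSVP_wrt B S"
proof -
  define h :: "real^'n^'m \<Rightarrow> real^'n^'m \<Rightarrow> (real^'n^'n) \<times> (real^'m^'m)"
    where "h B Y = (transpose B ** Y - transpose Y ** B, Y ** transpose B - B ** transpose Y)" for B Y
  define T where "T B Y = (h B Y, schur_prod S Y)" for B Y
  have SSVP_iff: "has_SSVP_wrt B S \<longleftrightarrow> (\<forall>Y. T B Y = 0 \<longrightarrow> Y = 0)" for B
    unfolding has_SSVP_wrt_def T_def h_def symmetric_mat_def
    by (simp add: zero_prod_def matrix_transpose_mul eq_commute[of "transpose Y ** B" for Y]
        eq_commute[of "B ** transpose Y" for Y])
  have bil: "bilinear h"
    unfolding bilinear_def
    by (auto intro!: linearI simp: h_def transpose_linear_simps linear_cmul[OF linear_transpose]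
        matrix_mul.add_left matrix_mul.add_right matrix_mul.scaleR_left matrix_mul.scaleR_right
        algebra_simps)
  then have lin: "linear (T A)"
    by (auto intro!: linearI simp: T_def bilinear_radd bilinear_rmul linear_add[OF linear_schur_prod]
        linear_cmul[OF linear_schur_prod])
  have "inj (T A)"
    using assms by (simp add: SSVP_iff linear_injective_0[OF lin])
  \<comment> \<open>An injective linear map in finite dimension is bounded below; it stays injective
    under perturbations of operator norm less than \<open>c\<close>.\<close>
  then obtain c where c: "c > 0" "\<And>Y. c * norm Y \<le> norm (T A Y)"
    using linear_inj_bounded_below_pos[OF lin] by blast
  obtain b where b: "b > 0" "\<And>B Y. norm (h B Y) \<le> b * norm B * norm Y"
    using bilinear_bounded_pos[OF bil] by blast
  show thesis
  proof
    show "c / b > 0"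
      using b c by simp
    fix B :: "real^'n^'m"
    assume B: "norm (B - A) < c / b"
    show "has_SSVP_wrt B S"
      unfolding SSVP_iff
    proof (intro allI impI)
      fix Y
      assume "T B Y = 0"
      \<comment> \<open>\<open>h\<close> is bilinear and vanishes at \<open>B\<close>,
        \<open>Y\<close>; the Schur component does not depend on the first matrix.\<close>
      then have "T A Y = (- h (B - A) Y, 0)"
        using bil by (simp add: T_def zero_prod_def bilinear_lsub)
      then have "norm (T A Y) = norm (h (B - A) Y)"
        by (simp add: norm_Pair)
      then have "c * norm Y \<le> b * norm (B - A) * norm Y"
        using c(2)[of Y] b(2)[of "B - A" Y] by linarith
      moreover have "b * norm (B - A) < c"
        using B b(1) by (simp add: field_simps)
      ultimately show "Y = 0"
        by (metis linorder_not_le mult_less_cancel_right_pos zero_less_norm_iff)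
    qed
  qed
qed

text \<open>Links openness, which holds for a fixed pattern, to the SSVP of the perturbed matrix
  once its pattern is known.\<close>

lemma has_SSVP_iff_wrt_pattern: "has_SSVP B \<longleftrightarrow> has_SSVP_wrt B (pattern_of B)"
proof -
  have "schur_prod (pattern_of B) X = 0 \<longleftrightarrow> schur_prod B X = 0" for X
    by (auto simp: schur_prod_def pattern_of_def vec_eq_iff)
  then show ?thesis
    unfolding has_SSVP_def has_SSVP_wrt_def by (simp add: conj_ac)
qed

lemma surj_if_orthogonal_range_trivial:
  fixes f :: "'a::euclidean_space \<Rightarrow> 'b::euclidean_space"
  assumes lin: "linear f" and "\<And>y. (\<And>x. y \<bullet> f x = 0) \<Longrightarrow> y = 0"
  shows "surj f"
proof (rule ccontr)
  assume "\<not> surj f"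
  then have "dim (range f) < DIM('b)"
    by (metis dim_eq_full dim_subset_UNIV linear_subspace_image lin nat_less_le span_eq_iff subspace_UNIV)
  then obtain y where "y \<noteq> 0" "\<And>z. z \<in> span (range f) \<Longrightarrow> orthogonal y z"
    using orthogonal_to_subspace_exists by blast
  then show False
    using assms(2)[of y] by (auto simp: orthogonal_def span_base)
qed

text \<open>A matrix \<open>Y\<close> orthogonal to the range is tested on one coordinate at a time:
  \<open>M\<close> and \<open>N\<close> yield the two symmetry conditions, \<open>X\<close> yields
  \<open>schur_prod S Y = 0\<close>, and the SSVP gives \<open>Y = 0\<close>.\<close>

lemma SSVP_transversal:
  fixes A S :: "real^'n^'m"
  assumes "has_SSVP_wrt A S"
  shows "surj (\<lambda>(M, N, X). (M - transpose M) ** A + A ** (N - transpose N) - schur_prod S X)"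
    (is "surj ?f")
proof (rule surj_if_orthogonal_range_trivial)
  show "linear ?f"
    by (rule linearI)
      (auto simp: transpose_linear_simps linear_cmul[OF linear_transpose]
        linear_add[OF linear_schur_prod] linear_cmul[OF linear_schur_prod]
        matrix_mul.add_left matrix_mul.add_right matrix_mul.diff_left matrix_mul.diff_right
        matrix_mul.scaleR_left matrix_mul.scaleR_right algebra_simps)
  fix Y
  assume Y: "Y \<bullet> ?f x = 0" for x
  have "(Y ** transpose A - transpose (Y ** transpose A)) \<bullet> M = Y \<bullet> ?f (M, 0, 0)" for M
    by (simp add: inner_matrix_mul_left inner_diff_left inner_diff_right inner_transpose_swap
        transpose_linear_simps linear_0[OF linear_schur_prod])
  then have "Y ** transpose A = transpose (Y ** transpose A)"
    using Y by (metis inner_eq_zero_iff eq_iff_diff_eq_0)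
  moreover have "(transpose A ** Y - transpose (transpose A ** Y)) \<bullet> N = Y \<bullet> ?f (0, N, 0)" for N
    by (simp add: inner_matrix_mul_right inner_diff_left inner_diff_right inner_transpose_swap
        transpose_linear_simps linear_0[OF linear_schur_prod])
  then have "transpose A ** Y = transpose (transpose A ** Y)"
    using Y by (metis inner_eq_zero_iff eq_iff_diff_eq_0)
  moreover have "schur_prod S Y \<bullet> X = - (Y \<bullet> ?f (0, 0, X))" for X
    by (simp add: inner_schur_prod transpose_linear_simps)
  then have "schur_prod S Y = 0"
    using Y by (metis inner_eq_zero_iff neg_equal_0_iff_equal)
  ultimately show "Y = 0"
    using assms by (simp add: has_SSVP_wrt_def symmetric_mat_def)
qed

section \<open>Construction of the matrix with pattern S\<close>

theorem theorem4p5: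
  fixes A D S :: "real^'n^'m"
  assumes "D \<in> Tan_Sigma A"
    and "S = pattern_in_direction A D"
    and "has_SSVP_wrt A S"
  shows "\<exists>B :: real^'n^'m. pattern_of B = S \<and> singular_values B = singular_values A \<and> has_SSVP B"
proof -
  obtain K L where D: "D = K ** A + A ** L" and KL: "skew_symmetric_mat K" "skew_symmetric_mat L"
    using assms(1) by (auto simp: Tan_Sigma_def)
  define g where "g = (\<lambda>(M, N, X). cayley M ** A ** cayley N - A - schur_prod S X)"
  define g' where "g' = (\<lambda>(M, N, X). (M - transpose M) ** A + A ** (N - transpose N) - schur_prod S X)"
  \<comment> \<open>The halves compensate for \<open>M - transpose M\<close> being twice
    \<open>M\<close> on skew-symmetric matrices.\<close>
  define v where "v = ((1/2) *\<^sub>R K, (1/2) *\<^sub>R L, D)"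
  have g_eq: "g = (\<lambda>w. cayley (fst w) ** A ** cayley (fst (snd w)) - A - schur_prod S (snd (snd w)))"
    by (simp add: g_def case_prod_unfold)
  have cont: "continuous_on UNIV g"
  proof -
    have 1: "continuous_on UNIV (\<lambda>w :: (real^'m^'m) \<times> (real^'n^'n) \<times> (real^'n^'m). cayley (fst w))"
      by (rule continuous_on_compose2[OF continuous_cayley])
        (intro continuous_on_fst continuous_on_snd continuous_on_id subset_UNIV)+
    have 2: "continuous_on UNIV (\<lambda>w :: (real^'m^'m) \<times> (real^'n^'n) \<times> (real^'n^'m). cayley (fst (snd w)))"
      by (rule continuous_on_compose2[OF continuous_cayley])
        (intro continuous_on_fst continuous_on_snd continuous_on_id subset_UNIV)+
    have 3: "continuous_on UNIV (\<lambda>w :: (real^'m^'m) \<times> (real^'n^'n) \<times> (real^'n^'m). schur_prod S (snd (snd w)))"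
      by (rule bounded_linear.continuous_on[OF linear_schur_prod[unfolded linear_conv_bounded_linear]])
        (intro continuous_on_snd continuous_on_id)
    show ?thesis
      unfolding g_eq
      by (intro continuous_on_diff matrix_mul.continuous_on continuous_on_const 1 2 3)
  qed
  have der: "(g has_derivative g') (at 0)"
  proof -
    have 1: "((\<lambda>w :: (real^'m^'m) \<times> (real^'n^'n) \<times> (real^'n^'m). cayley (fst w)) has_derivative (\<lambda>w. fst w - transpose (fst w))) (at 0)"
      by (rule has_derivative_compose[OF has_derivative_fst[OF has_derivative_ident]])
        (simp add: has_derivative_cayley)
    have 2: "((\<lambda>w :: (real^'m^'m) \<times> (real^'n^'n) \<times> (real^'n^'m). cayley (fst (snd w))) has_derivative
        (\<lambda>w. fst (snd w) - transpose (fst (snd w)))) (at 0)"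
      by (rule has_derivative_compose[OF has_derivative_fst[OF has_derivative_snd[OF has_derivative_ident]]])
        (simp add: has_derivative_cayley)
    have 3: "((\<lambda>w :: (real^'m^'m) \<times> (real^'n^'n) \<times> (real^'n^'m). schur_prod S (snd (snd w))) has_derivative (\<lambda>w. schur_prod S (snd (snd w)))) (at 0)"
      by (intro bounded_linear.has_derivative[OF linear_schur_prod[unfolded linear_conv_bounded_linear]]
          derivative_intros)
    show ?thesis
      unfolding g_eq
      by (rule has_derivative_eq_rhs,
          rule has_derivative_diff[OF has_derivative_diff[OF
            matrix_mul.FDERIV[OF matrix_mul.FDERIV[OF 1 has_derivative_const] 2] has_derivative_const] 3])
        (simp add: g'_def case_prod_unfold fun_eq_iff cayley_0)
  qed
  have g0: "g 0 = 0"
    by (simp add: g_eq cayley_0 linear_0[OF linear_schur_prod])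
  have surj: "surj g'"
    unfolding g'_def by (rule SSVP_transversal[OF assms(3)])
  have "schur_prod S D = D"
    by (simp add: assms(2) schur_prod_def pattern_in_direction_def vec_eq_iff)
  moreover have "(1/2) *\<^sub>R K - transpose ((1/2) *\<^sub>R K) = K" "(1/2) *\<^sub>R L - transpose ((1/2) *\<^sub>R L) = L"
    using KL[THEN skew_part_skew] by (simp_all add: skew_part_def transpose_scalar scaleR_diff_right)
  ultimately have g'v: "g' v = 0"
    by (simp only: g'_def v_def case_prod_conv) (simp add: D)
  \<comment> \<open>\<open>e\<close> lies strictly below the modulus of every nonzero entry of
    \<open>A\<close> and \<open>D\<close>; inserting 1 keeps the minimum meaningful when both
    matrices vanish.\<close>
  define Z where "Z = (\<lambda>p. A $ fst p $ snd p) ` UNIV \<union> (\<lambda>p. D $ fst p $ snd p) ` UNIV - {0}"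
  define e where "e = Min (insert 1 (abs ` Z)) / 2"
  have fin: "finite (insert 1 (abs ` Z))"
    by (simp add: Z_def)
  then have e_pos: "e > 0"
    by (auto simp: e_def Z_def)
  have e_less: "e < \<bar>x\<bar>" if "x \<in> Z" for x
    using Min_le[OF fin, of "\<bar>x\<bar>"] that e_pos by (simp add: e_def)
  obtain \<delta> where \<delta>: "\<delta> > 0" "\<And>B. norm (B - A) < \<delta> \<Longrightarrow> has_SSVP_wrt B S"
    using has_SSVP_wrt_open[OF assms(3)] by blast
  obtain d where d: "d > 0"
    "\<And>t. 0 < t \<Longrightarrow> t < d \<Longrightarrow> \<exists>w. g w = 0 \<and> norm (w - t *\<^sub>R v) \<le> e * t"
    using zeros_tangent_to_kernel[OF cont der g0 surj g'v e_pos] by blast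
  define c where "c = e + norm D"
  have c: "c > 0"
    using e_pos by (simp add: c_def add_pos_nonneg)
  \<comment> \<open>Since \<open>norm X \<le> t * c\<close> below, the bound by \<open>e\<close>
    protects the nonzero entries of \<open>A\<close>, and the bound by \<open>\<delta>\<close> keeps
    \<open>B\<close> where the SSVP with respect to \<open>S\<close> persists.\<close>
  obtain t where t: "0 < t" "t < d" "t * c < e" "t * c < \<delta>"
  proof
    show "0 < min d (min e \<delta> / c) / 2" "min d (min e \<delta> / c) / 2 < d"
        "min d (min e \<delta> / c) / 2 * c < e" "min d (min e \<delta> / c) / 2 * c < \<delta>"
      using d e_pos \<delta> c by (auto simp: min_def field_simps)
  qed
  obtain M N X where w: "g (M, N, X) = 0" "norm ((M, N, X) - t *\<^sub>R v) \<le> e * t"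
    using d(2)[OF t(1,2)] by (metis prod.exhaust)
  have X: "norm (X - t *\<^sub>R D) \<le> e * t"
    using norm_snd_le[of "(N - t *\<^sub>R (1/2) *\<^sub>R L, X - t *\<^sub>R D)" "M - t *\<^sub>R (1/2) *\<^sub>R K"]
      norm_snd_le[of "X - t *\<^sub>R D" "N - t *\<^sub>R (1/2) *\<^sub>R L"] w(2)
    by (simp add: v_def)
  define B where "B = A + schur_prod S X"
  have B: "B = cayley M ** A ** cayley N"
    using w(1) by (simp add: g_def B_def algebra_simps)
  have X_small: "norm X \<le> t * c"
  proof -
    have "norm X \<le> norm (X - t *\<^sub>R D) + norm (t *\<^sub>R D)"
      using norm_triangle_ineq[of "X - t *\<^sub>R D" "t *\<^sub>R D"] by simp
    also have "\<dots> \<le> e * t + t * norm D"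
      using X t(1) by simp
    finally show ?thesis
      by (simp add: c_def distrib_left mult.commute)
  qed
  have entry: "B $ i $ j \<noteq> 0 \<longleftrightarrow> A $ i $ j \<noteq> 0 \<or> D $ i $ j \<noteq> 0" for i j
  proof -
    have le: "\<bar>Y $ i $ j\<bar> \<le> norm Y" for Y :: "real^'n^'m"
      by (rule order_trans[OF component_le_norm_cart Finite_Cartesian_Product.norm_nth_le])
    consider "A $ i $ j \<noteq> 0" | "A $ i $ j = 0" "D $ i $ j \<noteq> 0" | "A $ i $ j = 0" "D $ i $ j = 0"
      by blast
    then show ?thesis
    proof cases
      case 1
      then have "e < \<bar>A $ i $ j\<bar>"
        by (intro e_less) (auto simp: Z_def image_iff)
      moreover have "\<bar>X $ i $ j\<bar> < e"
        using le[of X] X_small t by linarith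
      ultimately show ?thesis
        using 1 by (auto simp: B_def assms(2) schur_prod_def pattern_in_direction_def)
    next
      case 2
      then have "e < \<bar>D $ i $ j\<bar>"
        by (intro e_less) (auto simp: Z_def image_iff)
      \<comment> \<open>The error in \<open>X\<close> scales with \<open>t\<close> just as the main
        term does, so it cannot cancel \<open>t * D $ i $ j\<close> however small \<open>t\<close>
        is.\<close>
      then have "e * t < \<bar>t * D $ i $ j\<bar>"
        using t by (simp add: abs_mult mult.commute)
      moreover have "\<bar>X $ i $ j - t * D $ i $ j\<bar> \<le> e * t"
        using le[of "X - t *\<^sub>R D"] X by simp
      ultimately have "X $ i $ j \<noteq> 0"
        by auto
      then show ?thesis
        using 2 by (simp add: B_def assms(2) schur_prod_def pattern_in_direction_def)
    next
      case 3
      then show ?thesis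
        by (simp add: B_def assms(2) schur_prod_def pattern_in_direction_def)
    qed
  qed
  then have pattern: "pattern_of B = S"
    by (simp add: assms(2) pattern_of_def pattern_in_direction_def vec_eq_iff)
  \<comment> \<open>The entries of \<open>S\<close> are 0 or 1.\<close>
  have "norm (schur_prod S X) \<le> norm X"
    by (intro norm_le_componentwise_cart)
      (simp add: assms(2) schur_prod_def pattern_in_direction_def norm_le_componentwise_cart)
  then have "norm (B - A) < \<delta>"
    using X_small t by (simp add: B_def)
  then have "has_SSVP B"
    using \<delta>(2) by (simp add: has_SSVP_iff_wrt_pattern pattern)
  moreover have "singular_values B = singular_values A"
    unfolding B by (rule singular_values_orthogonal) (rule cayley_orthogonal)+
  ultimately show ?thesis
    using pattern by blast
qed

end
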